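(* Let $f$ be a meromorphic function on $\mathbb C$ that is algebraic over the field $\mathbb C(e^z)$, and set $m=[\mathbb C(e^z,f):\mathbb C(e^z)]$. Then $m$ is the least positive integer for which $$f(z+2\pi i m)=f(z)$$ holds identically. Moreover, $$\mathbb C(e^z,f)=\mathbb C(e^{z/m}).$$ In particular, $f=S(e^{z/m})$ for a rational function $S\in\mathbb C(u)$.
   Context: All fields are regarded as subfields of the field $\mathcal M(\mathbb C)$ of meromorphic functions on the whole complex plane. *)

theory Defs
  imports "HOL-Complex_Analysis.Complex_Analysis" "HOL-Algebra.Algebra"
begin

text \<open>
  The field of meromorphic functions on the whole plane. Its elements are represented by total
  functions that are normalised as in \<^const>\<open>nicely_meromorphic_on\<close>: no removable singularities,
  and value 0 at the poles. Every meromorphic function has exactly one such representative,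
  obtained by \<^const>\<open>remove_sings\<close>, so that equality in the field is equality of HOL functions.
  The pointwise sum or product of two representatives need not be normalised, hence the
  \<^const>\<open>remove_sings\<close> in the operations.
\<close>

definition mero_field :: "(complex \<Rightarrow> complex) ring" where
  "mero_field = \<lparr>carrier = {f. f nicely_meromorphic_on UNIV},
     mult = (\<lambda>f g. remove_sings (\<lambda>z. f z * g z)),
     one = (\<lambda>_. 1),
     ring.zero = (\<lambda>_. 0),
     add = (\<lambda>f g. remove_sings (\<lambda>z. f z + g z))\<rparr>"

text \<open>
  \<open>\<complex>(f\<^sub>1, f\<^sub>2, \<dots>)\<close>, the subfield of \<^const>\<open>mero_field\<close> generated by the constants and the
  functions in \<open>F\<close>.
\<close>

definition adjoin_C :: "(complex \<Rightarrow> complex) set \<Rightarrow> (complex \<Rightarrow> complex) set" where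
  "adjoin_C F = generate_field mero_field (range (\<lambda>c _. c) \<union> F)"

lemma remove_sings_nicely:
  assumes "f nicely_meromorphic_on UNIV"
  shows "remove_sings f = f"
proof
  fix z
  show "remove_sings f z = f z"
  proof (cases "is_pole f z")
    case True
    then show ?thesis
      using assms nicely_meromorphic_on_def is_pole_zero_at_nicely_mero[OF assms] by simp
  next
    case False
    then show ?thesis
      using assms unfolding nicely_meromorphic_on_def by (intro remove_sings_eqI) auto
  qed
qed

lemma eventually_remove_sings_eq:
  assumes "f meromorphic_on UNIV"
  shows "eventually (\<lambda>w. remove_sings f w = f w) (at z)"
  by (intro eventually_remove_sings_eq_at meromorphic_on_isolated_singularity
      meromorphic_on_subset[OF assms]) auto

lemma remove_sings_absorb:
  assumes "f meromorphic_on UNIV"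
  shows "remove_sings (\<lambda>z. h (remove_sings f z) z) = remove_sings (\<lambda>z. h (f z) z)"
proof
  fix z
  show "remove_sings (\<lambda>z. h (remove_sings f z) z) z = remove_sings (\<lambda>z. h (f z) z) z"
    by (rule remove_sings_cong)
      (use eventually_remove_sings_eq[OF assms, of z] in \<open>auto elim: eventually_mono\<close>)
qed

lemma field_mero_field: "field mero_field"
proof -
  let ?R = mero_field
  have nice: "remove_sings f nicely_meromorphic_on UNIV" if "f meromorphic_on UNIV" for f
    using that by (rule remove_sings_nicely_meromorphic)
  have mero: "f meromorphic_on UNIV" if "f nicely_meromorphic_on UNIV" for f
    using that by (simp add: nicely_meromorphic_on_def)
  have const: "(\<lambda>_. c) nicely_meromorphic_on UNIV" for c
    by auto
  have ab: "abelian_group ?R"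
  proof (rule abelian_groupI)
    fix f g h assume "f \<in> carrier ?R" "g \<in> carrier ?R" "h \<in> carrier ?R"
    then have fgh: "f meromorphic_on UNIV" "g meromorphic_on UNIV" "h meromorphic_on UNIV"
      by (auto simp: mero_field_def intro: mero)
    show "(f \<oplus>\<^bsub>?R\<^esub> g) \<oplus>\<^bsub>?R\<^esub> h = f \<oplus>\<^bsub>?R\<^esub> (g \<oplus>\<^bsub>?R\<^esub> h)"
      using remove_sings_absorb[of "\<lambda>z. f z + g z" "\<lambda>w z. w + h z"]
        remove_sings_absorb[of "\<lambda>z. g z + h z" "\<lambda>w z. f z + w"] fgh
      by (simp add: mero_field_def meromorphic_intros add.assoc)
  next
    fix f assume f: "f \<in> carrier ?R"
    then have "(\<lambda>z. - f z) nicely_meromorphic_on UNIV"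
      by (auto simp: mero_field_def)
    then show "\<exists>y\<in>carrier ?R. y \<oplus>\<^bsub>?R\<^esub> f = \<zero>\<^bsub>?R\<^esub>"
      using remove_sings_nicely[OF const[of 0]]
      by (intro bexI[of _ "\<lambda>z. - f z"]) (auto simp: mero_field_def)
  qed (auto simp: mero_field_def add.commute remove_sings_nicely const
      dest: mero intro!: nice meromorphic_on_add meromorphic_on_mult)
  have cm: "comm_monoid ?R"
  proof (rule comm_monoidI)
    fix f g h assume "f \<in> carrier ?R" "g \<in> carrier ?R" "h \<in> carrier ?R"
    then have fgh: "f meromorphic_on UNIV" "g meromorphic_on UNIV" "h meromorphic_on UNIV"
      by (auto simp: mero_field_def intro: mero)
    show "(f \<otimes>\<^bsub>?R\<^esub> g) \<otimes>\<^bsub>?R\<^esub> h = f \<otimes>\<^bsub>?R\<^esub> (g \<otimes>\<^bsub>?R\<^esub> h)"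
      using remove_sings_absorb[of "\<lambda>z. f z * g z" "\<lambda>w z. w * h z"]
        remove_sings_absorb[of "\<lambda>z. g z * h z" "\<lambda>w z. f z * w"] fgh
      by (simp add: mero_field_def meromorphic_intros mult.assoc)
  qed (auto simp: mero_field_def mult.commute remove_sings_nicely const
      dest: mero intro!: nice meromorphic_on_add meromorphic_on_mult)
  interpret cring ?R
  proof (rule cringI[OF ab cm])
    fix f g h assume "f \<in> carrier ?R" "g \<in> carrier ?R" "h \<in> carrier ?R"
    then have fgh: "f meromorphic_on UNIV" "g meromorphic_on UNIV" "h meromorphic_on UNIV"
      by (auto simp: mero_field_def intro: mero)
    show "(f \<oplus>\<^bsub>?R\<^esub> g) \<otimes>\<^bsub>?R\<^esub> h = f \<otimes>\<^bsub>?R\<^esub> h \<oplus>\<^bsub>?R\<^esub> g \<otimes>\<^bsub>?R\<^esub> h"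
      using remove_sings_absorb[of "\<lambda>z. f z + g z" "\<lambda>w z. w * h z"]
        remove_sings_absorb[of "\<lambda>z. f z * h z" "\<lambda>w z. w + remove_sings (\<lambda>z. g z * h z) z"]
        remove_sings_absorb[of "\<lambda>z. g z * h z" "\<lambda>w z. f z * h z + w"] fgh
      by (simp add: mero_field_def meromorphic_intros distrib_right)
  qed
  show ?thesis
  proof (rule cring_fieldI2)
    show "\<zero>\<^bsub>?R\<^esub> \<noteq> \<one>\<^bsub>?R\<^esub>"
      by (simp add: mero_field_def fun_eq_iff)
  next
    fix f assume "f \<in> carrier ?R" "f \<noteq> \<zero>\<^bsub>?R\<^esub>"
    then have f: "f nicely_meromorphic_on UNIV" and "\<exists>z. f z \<noteq> 0"
      by (auto simp: mero_field_def fun_eq_iff)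
    then have "\<forall>\<^sub>\<approx>z\<in>UNIV. f z \<noteq> 0"
      using nicely_meromorphic_imp_constant_or_avoid[OF f, of 0] by auto
    then have ev: "eventually (\<lambda>w. f w \<noteq> 0) (at z)" for z
      by (simp add: eventually_cosparse_open_eq)
    have "remove_sings (\<lambda>z. f z * inverse (f z)) = remove_sings (\<lambda>_. 1)"
    proof
      fix z
      show "remove_sings (\<lambda>z. f z * inverse (f z)) z = remove_sings (\<lambda>_. 1) z"
        by (rule remove_sings_cong) (use ev[of z] in \<open>auto elim: eventually_mono\<close>)
    qed
    then show "\<exists>g\<in>carrier ?R. f \<otimes>\<^bsub>?R\<^esub> g = \<one>\<^bsub>?R\<^esub>"
      using f by (intro bexI[of _ "\<lambda>z. inverse (f z)"])
        (auto simp: mero_field_def intro!: nicely_meromorphic_on_inverse)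
  qed
qed

text \<open>
  For \<open>f\<close> algebraic over \<open>K\<close> the extension \<open>K(f)\<close> is finite, so that its degree
  \<^term>\<open>(ring.dim mero_field over adjoin_C F) (adjoin_C (insert f F))\<close> is meaningful.
\<close>

lemma dimension_adjoin_C:
  assumes F: "F \<subseteq> carrier mero_field" and f: "f \<in> carrier mero_field"
    and alg: "(ring.algebraic mero_field over adjoin_C F) f"
  shows "ring.finite_dimension mero_field (adjoin_C F) (adjoin_C (insert f F))"
proof -
  interpret field mero_field by (rule field_mero_field)
  let ?K = "adjoin_C F"
  have C: "range (\<lambda>c _. c) \<union> F \<subseteq> carrier mero_field"
    using F by (auto simp: mero_field_def)
  then have K: "subfield ?K mero_field"
    unfolding adjoin_C_def by (rule generate_field_is_subfield)
  have L: "subfield (simple_extension ?K f) mero_field"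
    using simple_extension_is_subfield[OF K f] alg by simp
  have sub: "insert f ?K \<subseteq> simple_extension ?K f"
    using simple_extension_incl[OF subfieldE(3)[OF K] f] 
      simple_extension_mem[OF subfieldE(1)[OF K] f] by auto
  have "range (\<lambda>c _. c) \<union> insert f F \<subseteq> simple_extension ?K f"
    using sub unfolding adjoin_C_def by (auto intro: generate_field.incl)
  then have 1: "adjoin_C (insert f F) \<subseteq> simple_extension ?K f"
    using generate_field_min_subfield1[OF _ L] C f unfolding adjoin_C_def by auto
  have mono: "?K \<subseteq> adjoin_C (insert f F)"
    unfolding adjoin_C_def using F f C by (intro mono_generate_field) auto
  have "g \<in> adjoin_C (insert f F)" if "g \<in> simple_extension ?K f" for g
    using that
  proof induction
    case zero
    show ?case unfolding adjoin_C_def by (rule zero_in_generate)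
  next
    case (lin k1 k2)
    have "f \<in> adjoin_C (insert f F)"
      unfolding adjoin_C_def by (auto intro: generate_field.incl)
    moreover have "k2 \<in> adjoin_C (insert f F)"
      using lin mono by blast
    ultimately show ?case
      using lin.IH unfolding adjoin_C_def
      by (intro generate_field.eng_add generate_field.eng_mult)
  qed
  with 1 have "adjoin_C (insert f F) = simple_extension ?K f" by auto
  then show ?thesis
    using finite_dimension_simple_extension[OF K f] alg by (simp add: over_def)
qed

end

theory Submission
  imports Defs
begin

text \<open>
  Write the algebraic equation of \<open>f\<close> as \<open>P(e\<^sup>z, f) = 0\<close> with polynomial coefficients. The translates
  \<open>f(z + 2\<pi>ij)\<close> solve the same equation, so only finitely many of them are distinct; hence \<open>f\<close> has
  a least period \<open>2\<pi>ik\<close>, and \<open>k\<close> is at most the degree of \<open>f\<close> over \<open>\<complex>(e\<^sup>z)\<close>.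

  If \<open>a\<close> is the leading coefficient of \<open>P\<close>, then \<open>a(e\<^sup>z) f\<close> is integral over \<open>\<complex>[e\<^sup>z]\<close>, hence bounded
  by a polynomial in \<open>|e\<^sup>z|\<close>. So it is entire, and as a function of \<open>u = e\<^bsup>z/k\<^esup>\<close> it is
  holomorphic on the punctured plane, extends to \<open>u = 0\<close>, and is a polynomial by Liouville's theorem.
  Thus \<open>\<complex>(e\<^sup>z, f) \<subseteq> \<complex>(e\<^bsup>z/k\<^esup>)\<close>. The larger field has degree at most \<open>k\<close> over
  \<open>\<complex>(e\<^sup>z)\<close> and the smaller one at least \<open>k\<close>, so they coincide and \<open>m = k\<close>.
\<close>

hide_const (open) up_ring.coeff up_ring.monom Polynomials.degree Polynomials.lead_coeff

section \<open>Arithmetic in the field of meromorphic functions\<close>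

lemma mero_carrier_iff: "f \<in> carrier mero_field \<longleftrightarrow> f nicely_meromorphic_on UNIV"
  by (simp add: mero_field_def)

lemma mero_zero: "\<zero>\<^bsub>mero_field\<^esub> = (\<lambda>_. 0)" and mero_one: "\<one>\<^bsub>mero_field\<^esub> = (\<lambda>_. 1)"
  by (simp_all add: mero_field_def)

lemma mero_meromorphic: "f \<in> carrier mero_field \<Longrightarrow> f meromorphic_on UNIV"
  by (simp add: mero_field_def nicely_meromorphic_on_def)

lemma holomorphic_in_mero_field:
  assumes "f holomorphic_on UNIV"
  shows "f \<in> carrier mero_field"
  using assms by (simp add: mero_carrier_iff analytic_on_imp_nicely_meromorphic_on analytic_on_open)

lemma remove_sings_in_mero_field:
  "f meromorphic_on UNIV \<Longrightarrow> remove_sings f \<in> carrier mero_field"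
  by (simp add: mero_carrier_iff remove_sings_nicely_meromorphic)

lemma remove_sings_cosparse:
  "f meromorphic_on UNIV \<Longrightarrow> \<forall>\<^sub>\<approx>z\<in>UNIV. remove_sings f z = f z"
  by (simp add: eventually_cosparse_open_eq eventually_remove_sings_eq)

lemma remove_sings_cosparse_cong:
  assumes "\<forall>\<^sub>\<approx>z\<in>UNIV. f z = g z"
  shows "remove_sings f = remove_sings g"
proof
  fix z
  show "remove_sings f z = remove_sings g z"
    using assms by (intro remove_sings_cong) (auto simp: eventually_cosparse_open_eq)
qed

text \<open>Elements of the field are fixed by \<open>remove_sings\<close>, which ignores values on
  a sparse set. Identities in the field are therefore proved by computing pointwise off such a
  set.\<close>

lemma mero_eqI:
  assumes "f \<in> carrier mero_field" "g \<in> carrier mero_field" "\<forall>\<^sub>\<approx>z\<in>UNIV. f z = g z"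
  shows "f = g"
  using remove_sings_cosparse_cong[OF assms(3)] assms(1,2)
  by (simp add: mero_carrier_iff remove_sings_nicely)

lemma mero_add:
  assumes "f \<in> carrier mero_field" "g \<in> carrier mero_field"
  shows "\<forall>\<^sub>\<approx>z\<in>UNIV. (f \<oplus>\<^bsub>mero_field\<^esub> g) z = f z + g z"
  using remove_sings_cosparse[of "\<lambda>z. f z + g z"] assms[THEN mero_meromorphic]
  by (simp add: mero_field_def meromorphic_intros)

lemma mero_mult:
  assumes "f \<in> carrier mero_field" "g \<in> carrier mero_field"
  shows "\<forall>\<^sub>\<approx>z\<in>UNIV. (f \<otimes>\<^bsub>mero_field\<^esub> g) z = f z * g z"
  using remove_sings_cosparse[of "\<lambda>z. f z * g z"] assms[THEN mero_meromorphic]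
  by (simp add: mero_field_def meromorphic_intros)

lemma mero_nonzero_cosparse:
  assumes "f \<in> carrier mero_field" "f \<noteq> \<zero>\<^bsub>mero_field\<^esub>"
  shows "\<forall>\<^sub>\<approx>z\<in>UNIV. f z \<noteq> 0"
  using nicely_meromorphic_imp_constant_or_avoid[of f UNIV 0] assms
  by (auto simp: mero_field_def fun_eq_iff)

lemma mero_uminus:
  assumes "f \<in> carrier mero_field"
  shows "\<ominus>\<^bsub>mero_field\<^esub> f = (\<lambda>z. - f z)"
proof -
  interpret field mero_field by (rule field_mero_field)
  have c: "(\<lambda>z. - f z) \<in> carrier mero_field"
    using assms by (auto simp: mero_carrier_iff)
  have "(\<lambda>z. - f z) \<oplus>\<^bsub>mero_field\<^esub> f = \<zero>\<^bsub>mero_field\<^esub>"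
  proof (rule mero_eqI)
    show "\<forall>\<^sub>\<approx>z\<in>UNIV. ((\<lambda>z. - f z) \<oplus>\<^bsub>mero_field\<^esub> f) z = \<zero>\<^bsub>mero_field\<^esub> z"
      using mero_add[OF c assms] by (simp add: mero_zero)
  qed (use c assms in auto)
  then show ?thesis
    using minus_equality[OF _ assms c] by simp
qed

text \<open>Pointwise inversion needs no renormalisation: as \<open>inverse 0 = 0\<close>, a zero of
  \<open>f\<close> becomes a pole with value 0, and a pole, where \<open>f\<close> is 0 by
  convention, becomes a zero.\<close>

lemma mero_inv:
  assumes "f \<in> carrier mero_field" "f \<noteq> \<zero>\<^bsub>mero_field\<^esub>"
  shows "inv\<^bsub>mero_field\<^esub> f = (\<lambda>z. inverse (f z))"
proof -
  interpret field mero_field by (rule field_mero_field)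
  have c: "(\<lambda>z. inverse (f z)) \<in> carrier mero_field"
    using assms by (auto simp: mero_carrier_iff intro!: nicely_meromorphic_on_inverse)
  have "f \<otimes>\<^bsub>mero_field\<^esub> (\<lambda>z. inverse (f z)) = \<one>\<^bsub>mero_field\<^esub>"
  proof (rule mero_eqI)
    show "\<forall>\<^sub>\<approx>z\<in>UNIV. (f \<otimes>\<^bsub>mero_field\<^esub> (\<lambda>z. inverse (f z))) z = \<one>\<^bsub>mero_field\<^esub> z"
      using mero_mult[OF assms(1) c] mero_nonzero_cosparse[OF assms]
      by eventually_elim (simp add: mero_one)
  qed (use c assms in auto)
  then show ?thesis
    using comm_inv_char[OF assms(1) c] by simp
qed

lemma mero_pow:
  assumes "f \<in> carrier mero_field"
  shows "\<forall>\<^sub>\<approx>z\<in>UNIV. (f [^]\<^bsub>mero_field\<^esub> (n :: nat)) z = f z ^ n"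
proof (induction n)
  interpret field mero_field by (rule field_mero_field)
  case 0
  show ?case by (simp add: mero_one)
next
  interpret field mero_field by (rule field_mero_field)
  case (Suc n)
  then show ?case
    using mero_mult[OF nat_pow_closed[OF assms, of n] assms]
    by eventually_elim (simp add: mult.commute)
qed

section \<open>Translation of the argument\<close>

lemma eventually_cosparse_UNIV_shift:
  fixes c :: "'a :: real_normed_vector"
  assumes "\<forall>\<^sub>\<approx>z\<in>UNIV. Q z"
  shows "\<forall>\<^sub>\<approx>z\<in>UNIV. Q (z + c)"
proof -
  have "eventually (\<lambda>z. Q (z + c)) (at z)" for z
  proof -
    have "eventually Q (at (z + c))"
      using assms by (simp add: eventually_cosparse_open_eq)
    also have "at (z + c) = filtermap (\<lambda>x. x + c) (at z)"
      using filtermap_at_shift[of "- c" z] by simp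
    finally show ?thesis by (simp add: eventually_filtermap)
  qed
  then show ?thesis by (simp add: eventually_cosparse_open_eq)
qed

lemma mero_shift:
  assumes "f \<in> carrier mero_field"
  shows "(\<lambda>z. f (z + c)) \<in> carrier mero_field"
proof -
  have f: "f nicely_meromorphic_on UNIV"
    using assms by (simp add: mero_carrier_iff)
  have "(\<lambda>z. f (z + c)) meromorphic_on UNIV"
    by (rule meromorphic_on_compose[OF mero_meromorphic[OF assms]]) (auto intro!: analytic_intros)
  moreover have "is_pole (\<lambda>z. f (z + c)) z \<and> f (z + c) = 0 \<or> (\<lambda>z. f (z + c)) \<midarrow>z\<rightarrow> f (z + c)" for z
  proof -
    have "at (z + c) = filtermap (\<lambda>x. x + c) (at z)"
      using filtermap_at_shift[of "- c" z] by simp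
    then have "filterlim f F (at (z + c)) \<longleftrightarrow> filterlim (\<lambda>z. f (z + c)) F (at z)" for F
      by (simp add: filterlim_filtermap)
    moreover have "is_pole f (z + c) \<and> f (z + c) = 0 \<or> f \<midarrow>z + c\<rightarrow> f (z + c)"
      using f by (simp add: nicely_meromorphic_on_def)
    ultimately show ?thesis
      by (simp add: is_pole_def)
  qed
  ultimately show ?thesis by (simp add: mero_carrier_iff nicely_meromorphic_on_def)
qed

section \<open>Polynomials in an exponential\<close>

lemma holomorphic_poly_exp:
  fixes p :: "complex poly"
  shows "(\<lambda>z. poly p (exp (z / c))) holomorphic_on A"
  by (induction p) (auto intro!: holomorphic_intros simp: divide_inverse)

text \<open>The function \<open>exp (z / c)\<close> is transcendental over the constants: it takes
  every nonzero value, so a polynomial vanishing along it would have infinitely many roots.\<close>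

lemma poly_exp_nonzero_cosparse:
  fixes p :: "complex poly"
  assumes "p \<noteq> 0" "c \<noteq> 0"
  shows "\<forall>\<^sub>\<approx>z\<in>UNIV. poly p (exp (z / c)) \<noteq> 0"
proof (rule mero_nonzero_cosparse[of "\<lambda>z. poly p (exp (z / c))"])
  show "(\<lambda>z. poly p (exp (z / c))) \<in> carrier mero_field"
    by (rule holomorphic_in_mero_field[OF holomorphic_poly_exp])
  show "(\<lambda>z. poly p (exp (z / c))) \<noteq> \<zero>\<^bsub>mero_field\<^esub>"
  proof
    assume "(\<lambda>z. poly p (exp (z / c))) = \<zero>\<^bsub>mero_field\<^esub>"
    then have 0: "poly p (exp (z / c)) = 0" for z
      by (metis mero_zero)
    have "- {0} \<subseteq> {x. poly p x = 0}"
    proof safe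
      fix x :: complex assume "x \<noteq> 0"
      then show "poly p x = 0" using 0[of "c * Ln x"] \<open>c \<noteq> 0\<close> by simp
    qed
    moreover have "infinite (- {0 :: complex})"
      by (simp add: infinite_UNIV_char_0)
    ultimately show False
      using poly_roots_finite[OF \<open>p \<noteq> 0\<close>] finite_subset by blast
  qed
qed

text \<open>Induction over the field operations. The equation is kept free of division, so that
  zeros of \<open>q\<close> need no separate treatment.\<close>

lemma adjoin_C_exp_quotient:
  assumes "h \<in> adjoin_C {exp}"
  shows "\<exists>p q. q \<noteq> 0 \<and> (\<forall>\<^sub>\<approx>z\<in>UNIV. poly q (exp z) * h z = poly p (exp z))"
proof -
  interpret field mero_field by (rule field_mero_field)
  have C: "range (\<lambda>c _. c) \<union> {exp} \<subseteq> carrier mero_field"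
    using holomorphic_in_mero_field[OF holomorphic_on_exp] by (auto simp: mero_field_def)
  have car: "h \<in> carrier mero_field" if "h \<in> generate_field mero_field (range (\<lambda>c _. c) \<union> {exp})" for h
    using generate_field_in_carrier[OF C that] .
  note nz = poly_exp_nonzero_cosparse[where c = 1, simplified]
  show ?thesis
    using assms unfolding adjoin_C_def
  proof induction
    case one
    show ?case by (intro exI[of _ 1]) (simp add: mero_one)
  next
    case (incl h)
    then consider c where "h = (\<lambda>_. c)" | "h = exp" by auto
    then show ?case
    proof cases
      case 1
      then show ?thesis by (intro exI[of _ "[:c:]"] exI[of _ 1]) simp
    next
      case 2
      then show ?thesis by (intro exI[of _ "[:0, 1:]"] exI[of _ 1]) simp
    qed
  next
    case (a_inv h)
    then obtain p q where "q \<noteq> 0" "\<forall>\<^sub>\<approx>z\<in>UNIV. poly q (exp z) * h z = poly p (exp z)" by auto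
    then show ?case
      by (intro exI[of _ "- p"] exI[of _ q]) (auto simp: mero_uminus[OF car[OF a_inv.hyps]])
  next
    case (m_inv h)
    then obtain p q where pq: "q \<noteq> 0" "\<forall>\<^sub>\<approx>z\<in>UNIV. poly q (exp z) * h z = poly p (exp z)" by auto
    note h = mero_nonzero_cosparse[OF car[OF m_inv.hyps(1)] m_inv.hyps(2)]
    \<comment> \<open>Inversion swaps numerator and denominator, so the old numerator must be
      nonzero; otherwise \<open>h\<close> would vanish off a sparse set.\<close>
    have "p \<noteq> 0"
    proof
      assume "p = 0"
      with pq(2) have "\<forall>\<^sub>\<approx>z\<in>UNIV. poly q (exp z) * h z = 0" by simp
      with nz[OF pq(1)] h have "\<forall>\<^sub>\<approx>z\<in>(UNIV :: complex set). False"
        by eventually_elim simp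
      then show False by simp
    qed
    moreover have "\<forall>\<^sub>\<approx>z\<in>UNIV. poly p (exp z) * (inv\<^bsub>mero_field\<^esub> h) z = poly q (exp z)"
      using pq(2) h
      by eventually_elim (simp add: mero_inv[OF car[OF m_inv.hyps(1)] m_inv.hyps(2)] field_simps)
    ultimately show ?case by blast
  next
    case (eng_add h1 h2)
    then obtain p q p' q' where pq: "q \<noteq> 0" "\<forall>\<^sub>\<approx>z\<in>UNIV. poly q (exp z) * h1 z = poly p (exp z)"
      and pq': "q' \<noteq> 0" "\<forall>\<^sub>\<approx>z\<in>UNIV. poly q' (exp z) * h2 z = poly p' (exp z)" by auto
    have "\<forall>\<^sub>\<approx>z\<in>UNIV. poly (q * q') (exp z) * (h1 \<oplus>\<^bsub>mero_field\<^esub> h2) z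
        = poly (p * q' + p' * q) (exp z)"
      using pq(2) pq'(2) mero_add[OF eng_add.hyps[THEN car]]
    proof eventually_elim
      case (elim z)
      show ?case
        unfolding poly_mult poly_add elim(3) elim(1,2)[symmetric] by (simp add: algebra_simps)
    qed
    with pq pq' show ?case by (intro exI[of _ "p * q' + p' * q"] exI[of _ "q * q'"]) auto
  next
    case (eng_mult h1 h2)
    then obtain p q p' q' where pq: "q \<noteq> 0" "\<forall>\<^sub>\<approx>z\<in>UNIV. poly q (exp z) * h1 z = poly p (exp z)"
      and pq': "q' \<noteq> 0" "\<forall>\<^sub>\<approx>z\<in>UNIV. poly q' (exp z) * h2 z = poly p' (exp z)" by auto
    have "\<forall>\<^sub>\<approx>z\<in>UNIV. poly (q * q') (exp z) * (h1 \<otimes>\<^bsub>mero_field\<^esub> h2) z = poly (p * p') (exp z)"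
      using pq(2) pq'(2) mero_mult[OF eng_mult.hyps[THEN car]]
    proof eventually_elim
      case (elim z)
      show ?case
        unfolding poly_mult elim(3) elim(1,2)[symmetric] by (simp add: ac_simps)
    qed
    with pq pq' show ?case by (intro exI[of _ "p * p'"] exI[of _ "q * q'"]) auto
  qed
qed

section \<open>Fields generated over the constants\<close>

lemma adjoin_C_subfield:
  assumes "F \<subseteq> carrier mero_field"
  shows "subfield (adjoin_C F) mero_field"
proof -
  interpret field mero_field by (rule field_mero_field)
  have "range (\<lambda>c _. c) \<union> F \<subseteq> carrier mero_field"
    using assms by (auto simp: mero_field_def)
  then show ?thesis
    unfolding adjoin_C_def by (rule generate_field_is_subfield)
qed

lemma exp_in_mero_field: "(\<lambda>z. exp (z / c)) \<in> carrier mero_field"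
  by (rule holomorphic_in_mero_field) (auto intro!: holomorphic_intros simp: divide_inverse)

lemma adjoin_C_incl: "F \<subseteq> adjoin_C F" and adjoin_C_const: "(\<lambda>_. c) \<in> adjoin_C F"
  unfolding adjoin_C_def by (auto intro: generate_field.incl)

lemma adjoin_C_minimal:
  assumes "subfield E mero_field" "range (\<lambda>c _. c) \<subseteq> E" "F \<subseteq> E"
  shows "adjoin_C F \<subseteq> E"
proof -
  interpret field mero_field by (rule field_mero_field)
  have "range (\<lambda>c _. c) \<union> F \<subseteq> E"
    using assms by blast
  then show ?thesis
    using subfieldE(3)[OF assms(1)] unfolding adjoin_C_def
    by (intro generate_field_min_subfield1[OF _ assms(1)]) auto
qed

lemma adjoin_C_subsetI:
  assumes "G \<subseteq> carrier mero_field" "F \<subseteq> adjoin_C G"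
  shows "adjoin_C F \<subseteq> adjoin_C G"
  using adjoin_C_minimal[OF adjoin_C_subfield[OF assms(1)]] assms adjoin_C_const by blast

text \<open>Since \<open>f\<close> is algebraic, the ring K[f] is already a field. This makes the
  dimension theory of simple extensions available.\<close>

lemma adjoin_C_insert:
  assumes F: "F \<subseteq> carrier mero_field" and f: "f \<in> carrier mero_field"
    and alg: "(ring.algebraic mero_field over adjoin_C F) f"
  shows "adjoin_C (insert f F) = ring.simple_extension mero_field (adjoin_C F) f"
proof -
  interpret field mero_field by (rule field_mero_field)
  let ?K = "adjoin_C F"
  have K: "subfield ?K mero_field"
    by (rule adjoin_C_subfield[OF F])
  have L: "subfield (simple_extension ?K f) mero_field"
    using simple_extension_is_subfield[OF K f] alg by simp
  have sub: "insert f ?K \<subseteq> simple_extension ?K f"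
    using simple_extension_incl[OF subfieldE(3)[OF K] f]
      simple_extension_mem[OF subfieldE(1)[OF K] f] by auto
  have "adjoin_C (insert f F) \<subseteq> simple_extension ?K f"
    by (rule adjoin_C_minimal[OF L]) (use sub adjoin_C_incl adjoin_C_const in blast)+
  moreover have "simple_extension ?K f \<subseteq> adjoin_C (insert f F)"
  proof (rule simple_extension_subring_incl)
    show "subring (adjoin_C (insert f F)) mero_field"
      using F f by (intro subfieldE(1) adjoin_C_subfield) auto
    show "?K \<subseteq> adjoin_C (insert f F)"
      using F f adjoin_C_incl[of "insert f F"] by (intro adjoin_C_subsetI) auto
    show "f \<in> adjoin_C (insert f F)"
      using adjoin_C_incl[of "insert f F"] by auto
  qed
  ultimately show ?thesis by auto
qed

section \<open>Roots of polynomials and periodic functions\<close>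

text \<open>
  The product of a root with the leading coefficient is integral over the coefficients, hence the
  bound involves no division by \<open>c n\<close>.
\<close>

lemma norm_lead_mult_root_le:
  fixes c :: "nat \<Rightarrow> 'a :: real_normed_field"
  assumes "(\<Sum>i\<le>n. c i * y ^ i) = 0"
  shows "norm (c n * y) \<le> 1 + (\<Sum>i<n. norm (c i * c n ^ (n - 1 - i)))"
proof (cases n)
  case 0
  with assms show ?thesis by simp
next
  case (Suc m)
  let ?w = "c n * y" and ?S = "\<Sum>i<n. norm (c i * c n ^ (n - 1 - i))"
  have S: "?S \<ge> 0" by (intro sum_nonneg) auto
  \<comment> \<open>Multiplying by \<open>c n ^ (n - 1)\<close> turns the equation into a monic one
    for \<open>?w\<close>.\<close>
  have "0 = c n ^ m * (\<Sum>i\<le>n. c i * y ^ i)"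
    using assms by simp
  also have "\<dots> = c n ^ m * (c n * y ^ n) + c n ^ m * (\<Sum>i<n. c i * y ^ i)"
    by (simp add: lessThan_Suc_atMost[symmetric] distrib_left)
  also have "c n ^ m * (c n * y ^ n) = ?w ^ n"
    by (simp add: Suc power_mult_distrib)
  also have "c n ^ m * (\<Sum>i<n. c i * y ^ i) = (\<Sum>i<n. c i * c n ^ (n - 1 - i) * ?w ^ i)"
    unfolding sum_distrib_left
  proof (rule sum.cong)
    fix i assume "i \<in> {..<n}"
    then have "c n ^ m = c n ^ (n - 1 - i) * c n ^ i"
      by (simp add: Suc flip: power_add)
    then show "c n ^ m * (c i * y ^ i) = c i * c n ^ (n - 1 - i) * ?w ^ i"
      by (simp add: power_mult_distrib)
  qed simp
  finally have "?w ^ n = - (\<Sum>i<n. c i * c n ^ (n - 1 - i) * ?w ^ i)"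
    by (rule eq_neg_iff_add_eq_0[THEN iffD2, OF sym])
  then have eq: "norm ?w ^ n = norm (\<Sum>i<n. c i * c n ^ (n - 1 - i) * ?w ^ i)"
    unfolding norm_power[symmetric] by (simp only: norm_minus_cancel)
  show ?thesis
  proof (cases "norm ?w \<le> 1")
    case True
    with S show ?thesis by linarith
  next
    \<comment> \<open>If \<open>norm ?w > 1\<close>, dividing the monic equation by
      \<open>norm ?w ^ (n - 1)\<close> bounds \<open>norm ?w\<close> by the sum; the summand 1 in
      the claim covers the other case.\<close>
    case False
    have "norm ?w * norm ?w ^ m = norm ?w ^ n"
      by (simp add: Suc)
    also have "\<dots> \<le> (\<Sum>i<n. norm (c i * c n ^ (n - 1 - i)) * norm ?w ^ i)"
      unfolding eq by (intro order_trans[OF norm_sum] sum_mono) (simp add: norm_mult norm_power)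
    also have "\<dots> \<le> (\<Sum>i<n. norm (c i * c n ^ (n - 1 - i)) * norm ?w ^ m)"
      using False by (intro sum_mono mult_left_mono power_increasing) (auto simp: Suc)
    also have "\<dots> = ?S * norm ?w ^ m"
      by (simp add: sum_distrib_right)
    finally have "norm ?w \<le> ?S"
      by (rule mult_right_le_imp_le) (use False in \<open>intro zero_less_power, linarith\<close>)
    then show ?thesis by (simp add: Ball_def)
  qed
qed

text \<open>The base \<open>1 + norm x\<close> is at least 1, so all degrees can be raised to a
  common exponent, for small \<open>x\<close> too; the sum of the degrees serves as this
  exponent.\<close>

lemma sum_norm_poly_growth:
  fixes r :: "nat \<Rightarrow> 'a :: real_normed_field poly"
  shows "\<exists>B N. \<forall>x. (\<Sum>i<n. norm (poly (r i) x)) \<le> B * (1 + norm x) ^ N"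
proof (intro exI allI)
  fix x :: 'a
  let ?N = "\<Sum>i<n. degree (r i)"
  let ?b = "\<lambda>i. \<Sum>j\<le>degree (r i). norm (coeff (r i) j)"
  have "(\<Sum>i<n. norm (poly (r i) x)) \<le> (\<Sum>i<n. ?b i * (1 + norm x) ^ ?N)"
  proof (rule sum_mono)
    fix i assume i: "i \<in> {..<n}"
    have "norm (poly (r i) x) \<le> (\<Sum>j\<le>degree (r i). norm (coeff (r i) j) * norm x ^ j)"
      unfolding poly_altdef by (rule order_trans[OF norm_sum]) (simp add: norm_mult norm_power)
    also have "\<dots> \<le> (\<Sum>j\<le>degree (r i). norm (coeff (r i) j) * (1 + norm x) ^ ?N)"
    proof (intro sum_mono mult_left_mono)
      fix j assume "j \<in> {..degree (r i)}"
      moreover have "degree (r i) \<le> ?N"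
        using i by (intro member_le_sum) auto
      ultimately have "(1 + norm x) ^ j \<le> (1 + norm x) ^ ?N"
        by (intro power_increasing) auto
      moreover have "norm x ^ j \<le> (1 + norm x) ^ j"
        by (intro power_mono) auto
      ultimately show "norm x ^ j \<le> (1 + norm x) ^ ?N" by linarith
    qed auto
    also have "\<dots> = ?b i * (1 + norm x) ^ ?N"
      by (simp add: sum_distrib_right)
    finally show "norm (poly (r i) x) \<le> ?b i * (1 + norm x) ^ ?N" .
  qed
  also have "\<dots> = (\<Sum>i<n. ?b i) * (1 + norm x) ^ ?N"
    by (simp add: sum_distrib_right)
  finally show "(\<Sum>i<n. norm (poly (r i) x)) \<le> (\<Sum>i<n. ?b i) * (1 + norm x) ^ ?N" .
qed

text \<open>
  \<^term>\<open>poly (poly P [:y:]) x\<close> is the value of \<open>P \<in> \<complex>[x][y]\<close> at \<open>(x, y)\<close>: the outer variable of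
  \<open>P\<close> is \<open>y\<close>.
\<close>

lemma poly_poly_const_altdef:
  fixes P :: "'a :: comm_ring_1 poly poly"
  shows "poly (poly P [:y:]) x = (\<Sum>i\<le>degree P. poly (coeff P i) x * y ^ i)"
  by (simp add: poly_altdef[of P] poly_sum poly_const_pow mult.commute)

lemma poly_root_norm_bound:
  fixes P :: "'a :: real_normed_field poly poly"
  shows "\<exists>B N. \<forall>x y. poly (poly P [:y:]) x = 0 \<longrightarrow>
    norm (poly (lead_coeff P) x * y) \<le> B * (1 + norm x) ^ N"
proof -
  let ?n = "degree P"
  \<comment> \<open>The extra entry 1 at index \<open>?n\<close> accounts for the summand 1 in the
    root bound.\<close>
  define r where "r i = (if i < ?n then coeff P i * lead_coeff P ^ (?n - 1 - i) else 1)" for i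
  obtain B N where BN: "(\<Sum>i<Suc ?n. norm (poly (r i) x)) \<le> B * (1 + norm x) ^ N" for x
    using sum_norm_poly_growth by blast
  have "norm (poly (lead_coeff P) x * y) \<le> B * (1 + norm x) ^ N"
    if "poly (poly P [:y:]) x = 0" for x y
  proof -
    have "norm (poly (lead_coeff P) x * y)
        \<le> 1 + (\<Sum>i<?n. norm (poly (coeff P i) x * poly (lead_coeff P) x ^ (?n - 1 - i)))"
      by (rule norm_lead_mult_root_le) (use that in \<open>simp add: poly_poly_const_altdef\<close>)
    also have "\<dots> = (\<Sum>i<Suc ?n. norm (poly (r i) x))"
      by (simp add: r_def)
    finally show ?thesis using BN[of x] by linarith
  qed
  then show ?thesis by blast
qed

section \<open>Periodic functions as functions of e^(z/k)\<close>

lemma exp_plus_2pi_nat: "exp (z + 2 * of_real pi * \<i> * of_nat k) = exp z"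
  using exp_plus_2pin[of z "int k"] by (simp add: ac_simps)

lemma periodic_int_multiple:
  fixes g :: "'a :: ring_1 \<Rightarrow> 'b"
  assumes "\<And>z. g (z + c) = g z"
  shows "g (z + of_int n * c) = g z"
proof (induction n rule: int_induct[where k = 0])
  case (step1 i)
  then show ?case using assms[of "z + of_int i * c"] by (simp add: algebra_simps)
next
  case (step2 i)
  then show ?case using assms[of "z + of_int (i - 1) * c"] by (simp add: algebra_simps)
qed simp

lemma periodic_entire_exp_polynomial:
  fixes g :: "complex \<Rightarrow> complex" and k :: nat
  assumes holo: "g holomorphic_on UNIV" and k: "k > 0"
    and per: "\<And>z. g (z + 2 * of_real pi * \<i> * of_nat k) = g z"
    and bound: "\<And>z. norm (g z) \<le> B * (1 + norm (exp z)) ^ N"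
  shows "\<exists>p. \<forall>z. g z = poly p (exp (z / of_nat k))"
proof -
  \<comment> \<open>\<open>G\<close> is \<open>g\<close> in the coordinate u = e^(z/k). The choice
    of logarithm does not matter: a change by 2 pi i, multiplied by \<open>k\<close>, is a period of
    \<open>g\<close>.\<close>
  define G where "G u = g (of_nat k * Ln u)" for u
  have G_exp: "G (exp w) = g (of_nat k * w)" for w
  proof -
    obtain n :: int where n: "Ln (exp w) = w + of_int (2 * n) * pi * \<i>"
      using exp_eq[of "Ln (exp w)" w] by auto
    have "G (exp w) = g (of_nat k * w + of_int n * (2 * of_real pi * \<i> * of_nat k))"
      unfolding G_def n by (simp add: algebra_simps)
    then show ?thesis using periodic_int_multiple[of g, OF per] by simp
  qed
  have B: "B \<ge> 0"
    using order_trans[OF norm_ge_zero bound[of 0]]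
    by (simp add: zero_le_mult_iff power_le_zero_eq)
  have G_bound: "norm (G u) \<le> B * (1 + norm u ^ k) ^ N" if "u \<noteq> 0" for u
  proof -
    have "exp (of_nat k * Ln u) = u ^ k"
      using that by (simp add: exp_of_nat_mult)
    then show ?thesis
      unfolding G_def using bound[of "of_nat k * Ln u"] by (simp add: norm_power)
  qed
  have "G analytic_on {u}" if u: "u \<noteq> 0" for u
  proof -
    have nonpos: "w / u \<notin> \<real>\<^sub>\<le>\<^sub>0" and w0: "w \<noteq> 0" if "w \<in> ball u (norm u)" for w
    proof -
      have "w / u - 1 = - ((u - w) / u)"
        using u by (simp add: field_simps)
      then have "norm (w / u - 1) < 1"
        using that u by (simp add: norm_divide dist_norm)
      then have "Re (w / u) > 0"
        using abs_Re_le_cmod[of "w / u - 1"] by simp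
      then show "w / u \<notin> \<real>\<^sub>\<le>\<^sub>0" by (auto simp: complex_nonpos_Reals_iff)
      show "w \<noteq> 0" using that by auto
    qed
    \<comment> \<open>The branch \<open>Ln (w / u) + Ln u\<close> is holomorphic on the whole disc,
      even where the principal branch has its cut.\<close>
    have "(\<lambda>w. g (of_nat k * (Ln (w / u) + Ln u))) holomorphic_on ball u (norm u)"
      using nonpos u
      by (intro holomorphic_on_compose_gen[OF _ holo, unfolded o_def] holomorphic_intros) auto
    also have "?this \<longleftrightarrow> G holomorphic_on ball u (norm u)"
    proof (rule holomorphic_cong[OF refl])
      fix w assume "w \<in> ball u (norm u)"
      then have "exp (Ln (w / u) + Ln u) = w"
        using u w0 by (simp add: exp_add)
      then show "g (of_nat k * (Ln (w / u) + Ln u)) = G w"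
        using G_exp[of "Ln (w / u) + Ln u"] by simp
    qed
    finally show ?thesis
      unfolding analytic_at_ball using u by (intro exI[of _ "norm u"]) simp
  qed
  then have "G analytic_on UNIV - {0}"
    by (subst analytic_on_analytic_at) simp
  then have "G holomorphic_on UNIV - {0}"
    by (rule analytic_imp_holomorphic)
  \<comment> \<open>Boundedness near 0 makes the singularity there removable.\<close>
  moreover have "eventually (\<lambda>u. norm (G u) \<le> B * 2 ^ N) (at 0)"
    unfolding eventually_at
  proof (intro exI[of _ 1] conjI ballI impI)
    fix u :: complex assume u: "u \<noteq> 0 \<and> dist u 0 < 1"
    then have "norm u ^ k \<le> 1" by (simp add: power_le_one)
    then have "B * (1 + norm u ^ k) ^ N \<le> B * 2 ^ N"
      using B by (intro mult_left_mono power_mono) auto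
    with G_bound[of u] u show "norm (G u) \<le> B * 2 ^ N" by linarith
  qed simp
  ultimately obtain H where H: "H holomorphic_on UNIV" "\<And>u. u \<noteq> 0 \<Longrightarrow> H u = G u"
    using holomorphic_on_extend_bounded[of G UNIV 0] by auto
  \<comment> \<open>These are the Taylor coefficients of \<open>H\<close> at 0. Since 1 + |u|^k is
    at most 2 |u|^k for |u| at least 1, the growth bounds the degree by
    \<open>k * N\<close>.\<close>
  define c where "c j = (deriv ^^ j) H 0 / fact j" for j
  have "H u = (\<Sum>j\<le>k * N. c j * u ^ j)" for u
    unfolding c_def
  proof (rule Liouville_polynomial[OF H(1)])
    fix z :: complex assume z: "1 \<le> norm z"
    then have "norm z ^ k \<ge> 1" by simp
    then have "(1 + norm z ^ k) ^ N \<le> (2 * norm z ^ k) ^ N"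
      by (intro power_mono) auto
    then have "B * (1 + norm z ^ k) ^ N \<le> B * (2 * norm z ^ k) ^ N"
      using B by (rule mult_left_mono)
    moreover have "z \<noteq> 0" using z by auto
    ultimately show "norm (H z) \<le> B * 2 ^ N * norm z ^ (k * N)"
      using G_bound[of z] H(2)[of z] by (simp add: power_mult_distrib power_mult mult.assoc)
  qed
  then have "g z = poly (\<Sum>j\<le>k * N. monom (c j) j) (exp (z / of_nat k))" for z
    using G_exp[of "z / of_nat k"] H(2)[of "exp (z / of_nat k)"] k
    by (simp add: poly_sum poly_monom)
  then show ?thesis by blast
qed

text \<open>As a(e^z) is itself a polynomial in e^(z/k), finding such a polynomial for a(e^z) f
  presents \<open>f\<close> as a quotient.\<close>

lemma periodic_algebraic_imp_rational:
  fixes P :: "complex poly poly" and k :: nat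
  assumes f: "f \<in> carrier mero_field" and P: "P \<noteq> 0"
    and root: "\<forall>\<^sub>\<approx>z\<in>UNIV. poly (poly P [:f z:]) (exp z) = 0"
    and k: "k > 0" and per: "\<And>z. f (z + 2 * of_real pi * \<i> * of_nat k) = f z"
  shows "\<exists>p q. q \<noteq> 0 \<and>
    f = remove_sings (\<lambda>z. poly p (exp (z / of_nat k)) / poly q (exp (z / of_nat k)))"
proof -
  define a where "a = lead_coeff P"
  define g0 where "g0 z = poly a (exp z) * f z" for z
  define g where "g = remove_sings g0"
  define T where "T = 2 * of_real pi * \<i> * of_nat k"
  have a_holo: "(\<lambda>z. poly a (exp z)) holomorphic_on UNIV"
    using holomorphic_poly_exp[of a 1] by simp
  have "g0 meromorphic_on UNIV"
    unfolding g0_def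
    using mero_meromorphic[OF f] mero_meromorphic[OF holomorphic_in_mero_field[OF a_holo]]
    by (intro meromorphic_intros)
  then have g: "g \<in> carrier mero_field" and g_eq: "\<forall>\<^sub>\<approx>z\<in>UNIV. g z = g0 z"
    unfolding g_def by (auto intro: remove_sings_in_mero_field remove_sings_cosparse)
  obtain B N where BN: "\<And>x y. poly (poly P [:y:]) x = 0 \<Longrightarrow>
      norm (poly a x * y) \<le> B * (1 + norm x) ^ N"
    using poly_root_norm_bound[of P] unfolding a_def by blast
  let ?b = "\<lambda>z. B * (1 + norm (exp z)) ^ N"
  have g_le: "\<forall>\<^sub>\<approx>z\<in>UNIV. norm (g z) \<le> ?b z"
    using g_eq root by eventually_elim (simp add: g0_def BN del: norm_exp_eq_Re)
  have b: "(?b \<longlongrightarrow> ?b z) (at z)" for z :: complex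
    by (intro tendsto_intros)
  \<comment> \<open>Near \<open>z\<close> the bound \<open>?b\<close> stays finite by continuity,
    whereas \<open>g\<close> would be unbounded at a pole.\<close>
  have "\<not> is_pole g z" for z
  proof
    assume "is_pole g z"
    then have "eventually (\<lambda>w. norm (g w) > ?b z + 1) (at z)"
      unfolding is_pole_def filterlim_at_infinity_conv_norm_at_top filterlim_at_top_dense by blast
    moreover have "eventually (\<lambda>w. ?b w < ?b z + 1) (at z)"
      by (rule order_tendstoD(2)[OF b]) simp
    moreover have "eventually (\<lambda>w. norm (g w) \<le> ?b w) (at z)"
      using g_le by (simp add: eventually_cosparse_open_eq)
    ultimately have "eventually (\<lambda>_. False) (at z)"
      by eventually_elim linarith
    then show False by simp
  qed
  then have g_ana: "g analytic_on UNIV"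
    using nicely_meromorphic_without_singularities[of g UNIV] g by (simp add: mero_carrier_iff)
  have "\<exists>p. \<forall>z. g z = poly p (exp (z / of_nat k))"
  proof (rule periodic_entire_exp_polynomial[OF analytic_imp_holomorphic[OF g_ana] k])
    fix z
    \<comment> \<open>The relation between \<open>g\<close> and \<open>f\<close> is known only off a
      sparse set; being normalised, \<open>g\<close> inherits the period everywhere.\<close>
    have "(\<lambda>w. g (w + T)) = g"
    proof (rule mero_eqI[OF mero_shift[OF g] g])
      show "\<forall>\<^sub>\<approx>z\<in>UNIV. g (z + T) = g z"
        using g_eq eventually_cosparse_UNIV_shift[OF g_eq, of T]
        by eventually_elim (simp add: g0_def T_def exp_plus_2pi_nat per)
    qed
    then show "g (z + 2 * of_real pi * \<i> * of_nat k) = g z"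
      unfolding T_def[symmetric] by metis
    \<comment> \<open>Continuity carries the bound over to the exceptional points.\<close>
    have "isCont g z"
      using g_ana analytic_at_imp_isCont analytic_on_analytic_at by blast
    then have "((\<lambda>w. norm (g w)) \<longlongrightarrow> norm (g z)) (at z)"
      by (intro tendsto_norm) (simp add: isContD)
    then show "norm (g z) \<le> ?b z"
      using g_le by (intro tendsto_le[OF _ b]) (auto simp: eventually_cosparse_open_eq)
  qed
  then obtain p where p: "\<And>z. g z = poly p (exp (z / of_nat k))" by blast
  \<comment> \<open>Substituting u^k for the variable of \<open>a\<close> expresses a(e^z) through u
    = e^(z/k).\<close>
  define q where "q = a \<circ>\<^sub>p monom 1 k"
  have "q \<noteq> 0"
    unfolding q_def a_def using pcompose_eq_0[of "lead_coeff P" "monom 1 k"] P k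
    by (auto simp: degree_monom_eq)
  have q: "poly q (exp (z / of_nat k)) = poly a (exp z)" for z :: complex
    using k by (simp add: q_def poly_pcompose poly_monom exp_divide_power_eq)
  let ?r = "\<lambda>z. poly p (exp (z / of_nat k)) / poly q (exp (z / of_nat k))"
  have r: "?r meromorphic_on UNIV"
    by (intro meromorphic_intros mero_meromorphic holomorphic_in_mero_field holomorphic_poly_exp)
  have nz: "\<forall>\<^sub>\<approx>z\<in>UNIV. poly q (exp (z / of_nat k)) \<noteq> 0"
    using \<open>q \<noteq> 0\<close> k by (intro poly_exp_nonzero_cosparse) auto
  have "f = remove_sings ?r"
  proof (rule mero_eqI[OF f remove_sings_in_mero_field[OF r]])
    show "\<forall>\<^sub>\<approx>z\<in>UNIV. f z = remove_sings ?r z"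
      using nz g_eq remove_sings_cosparse[OF r]
    proof eventually_elim
      case (elim z)
      then have "?r z = f z"
        unfolding p[symmetric] q by (simp add: g0_def)
      with elim show ?case by simp
    qed
  qed
  with \<open>q \<noteq> 0\<close> show ?thesis by blast
qed

text \<open>The translates of \<open>f\<close> solve the same equation because its coefficients have
  period 2 pi i. At a generic \<open>z\<close> the values of \<open>n\<close> distinct translates
  are distinct roots of one nonzero polynomial.\<close>

lemma conjugates_le_degree:
  fixes P :: "complex poly poly"
  assumes f: "f \<in> carrier mero_field" and P: "P \<noteq> 0"
    and root: "\<forall>\<^sub>\<approx>z\<in>UNIV. poly (poly P [:f z:]) (exp z) = 0"
    and distinct: "\<And>i j. i < j \<Longrightarrow> j < n \<Longrightarrow>
      \<exists>z. f (z + 2 * of_real pi * \<i> * of_nat i) \<noteq> f (z + 2 * of_real pi * \<i> * of_nat j)"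
  shows "n \<le> degree P"
proof -
  define F where "F i z = f (z + 2 * of_real pi * \<i> * of_nat i)" for i z
  have F: "F i \<in> carrier mero_field" for i
    unfolding F_def by (rule mero_shift[OF f])
  have roots: "\<forall>\<^sub>\<approx>z\<in>UNIV. \<forall>i<n. poly (poly P [:F i z:]) (exp z) = 0"
  proof -
    have "\<forall>\<^sub>\<approx>z\<in>UNIV. poly (poly P [:F i z:]) (exp z) = 0" for i
      unfolding F_def
      using eventually_cosparse_UNIV_shift[OF root, of "2 * of_real pi * \<i> * of_nat i"]
      by (simp only: exp_plus_2pi_nat)
    then have "\<forall>\<^sub>\<approx>z\<in>UNIV. \<forall>i\<in>{..<n}. poly (poly P [:F i z:]) (exp z) = 0"
      by (intro eventually_ball_finite) auto
    then show ?thesis by (simp add: Ball_def)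
  qed
  \<comment> \<open>Two different meromorphic functions on the connected plane agree only on a
    sparse set.\<close>
  have "\<forall>\<^sub>\<approx>z\<in>UNIV. F i z \<noteq> F j z" if "i < j" "j < n" for i j
  proof -
    have "(\<lambda>z. F i z - F j z) meromorphic_on UNIV"
      by (intro meromorphic_intros mero_meromorphic F)
    then consider "\<forall>\<^sub>\<approx>z\<in>UNIV. F i z - F j z = 0" | "\<forall>\<^sub>\<approx>z\<in>UNIV. F i z - F j z \<noteq> 0"
      using meromorphic_imp_constant_or_avoid[of "\<lambda>z. F i z - F j z" UNIV 0] by auto
    then show ?thesis
    proof cases
      case 1
      then have "F i = F j" by (intro mero_eqI F) simp
      then show ?thesis using distinct[OF that] by (auto simp: F_def fun_eq_iff)
    qed simp
  qed
  then have dist: "\<forall>\<^sub>\<approx>z\<in>UNIV. \<forall>j\<in>{..<n}. \<forall>i\<in>{..<j}. F i z \<noteq> F j z"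
    by (intro eventually_ball_finite ballI) auto
  have lead: "\<forall>\<^sub>\<approx>z\<in>UNIV. poly (lead_coeff P) (exp z) \<noteq> 0"
    using poly_exp_nonzero_cosparse[of "lead_coeff P" 1] P by simp
  \<comment> \<open>The claim does not involve \<open>z\<close>; one point off the exceptional set
    suffices.\<close>
  have "\<forall>\<^sub>\<approx>z\<in>(UNIV :: complex set). n \<le> degree P"
    using roots dist lead
  proof eventually_elim
    case (elim z)
    \<comment> \<open>\<open>Q\<close> is P(e^z, y) in the variable y for fixed \<open>z\<close>;
      its degree does not drop, as the leading coefficient of \<open>P\<close> does not vanish
      there.\<close>
    define Q where "Q = map_poly (\<lambda>c. poly c (exp z)) P"
    have Q: "coeff Q i = poly (coeff P i) (exp z)" for i
      by (simp add: Q_def coeff_map_poly)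
    have deg: "degree Q = degree P"
      using elim(3) by (intro antisym degree_le le_degree) (auto simp: Q coeff_eq_0)
    have "Q \<noteq> 0"
      using elim(3) Q[of "degree P"] by auto
    have "inj_on (\<lambda>i. F i z) {..<n}"
      using elim(2) by (intro linorder_inj_onI) auto
    then have "n = card ((\<lambda>i. F i z) ` {..<n})"
      by (simp add: card_image)
    also have "\<dots> \<le> card {y. poly Q y = 0}"
      using elim(1) poly_roots_finite[OF \<open>Q \<noteq> 0\<close>]
      by (intro card_mono) (auto simp: poly_poly_const_altdef poly_altdef[of Q] Q deg)
    also have "\<dots> \<le> degree P"
      using card_poly_roots_bound[OF \<open>Q \<noteq> 0\<close>] by (simp add: deg)
    finally show ?case .
  qed
  then show ?thesis by simp
qed

section \<open>Degrees over the rational functions of the exponential\<close>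

text \<open>Passage from a list polynomial over C(e^z), highest coefficient first, to a polynomial
  in two variables. The vanishing of the coefficients from \<open>length cs\<close> on bounds the
  degree and keeps the next leading term from cancelling in the induction.\<close>

lemma eval_clear_denominators:
  assumes f: "f \<in> carrier mero_field" and "set cs \<subseteq> adjoin_C {exp}"
  shows "\<exists>P q. q \<noteq> 0 \<and> (\<forall>i\<ge>length cs. poly.coeff P i = 0)
    \<and> (cs \<noteq> [] \<and> hd cs \<noteq> \<zero>\<^bsub>mero_field\<^esub> \<longrightarrow> P \<noteq> 0)
    \<and> (\<forall>\<^sub>\<approx>z\<in>UNIV. poly q (exp z) * ring.eval mero_field cs f z = poly (poly P [:f z:]) (exp z))"
  using assms(2)
proof (induction cs)
  interpret field mero_field by (rule field_mero_field)
  case Nil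
  show ?case by (intro exI[of _ 0] exI[of _ 1]) (simp add: mero_zero)
next
  interpret field mero_field by (rule field_mero_field)
  have K: "adjoin_C {exp} \<subseteq> carrier mero_field"
    using subfieldE(3)[OF adjoin_C_subfield[of "{exp}"]] exp_in_mero_field[of 1] by simp
  case (Cons a cs)
  let ?n = "length cs"
  obtain P q where q: "q \<noteq> 0" and P: "\<forall>i\<ge>?n. poly.coeff P i = 0"
    and eq: "\<forall>\<^sub>\<approx>z\<in>UNIV. poly q (exp z) * eval cs f z = poly (poly P [:f z:]) (exp z)"
    using Cons by auto
  obtain p' q' where q': "q' \<noteq> 0" and eq': "\<forall>\<^sub>\<approx>z\<in>UNIV. poly q' (exp z) * a z = poly p' (exp z)"
    using adjoin_C_exp_quotient[of a] Cons.prems by auto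
  have a: "a \<in> carrier mero_field" and cs: "set cs \<subseteq> carrier mero_field"
    using Cons.prems K by auto
  \<comment> \<open>Both summands are brought to the common denominator
    \<open>q' * q\<close>.\<close>
  define P' where "P' = Polynomial.monom (p' * q) ?n + Polynomial.smult q' P"
  have "\<forall>\<^sub>\<approx>z\<in>UNIV. poly (q' * q) (exp z) * eval (a # cs) f z = poly (poly P' [:f z:]) (exp z)"
    using eq eq' mero_add[OF m_closed[OF a nat_pow_closed[OF f, of ?n]] eval_in_carrier[OF cs f]]
      mero_mult[OF a nat_pow_closed[OF f, of ?n]] mero_pow[OF f, of ?n]
  proof eventually_elim
    case (elim z)
    have "poly (q' * q) (exp z) * eval (a # cs) f z
        = (poly q' (exp z) * a z) * poly q (exp z) * f z ^ ?n
          + poly q' (exp z) * (poly q (exp z) * eval cs f z)"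
      using elim(3-5) by (simp add: algebra_simps)
    also have "\<dots> = poly (poly P' [:f z:]) (exp z)"
      unfolding elim(1,2) P'_def by (simp add: poly_monom poly_const_pow)
    finally show ?case .
  qed
  moreover have "P' \<noteq> 0" if nz: "a \<noteq> \<zero>\<^bsub>mero_field\<^esub>"
  proof
    assume "P' = 0"
    then have "poly.coeff P' ?n = 0" by simp
    then have "p' = 0" using P q by (simp add: P'_def)
    with eq' have "\<forall>\<^sub>\<approx>z\<in>UNIV. poly q' (exp z) * a z = 0" by simp
    with poly_exp_nonzero_cosparse[where c = 1, simplified, OF q'] mero_nonzero_cosparse[OF a nz]
    have "\<forall>\<^sub>\<approx>z\<in>(UNIV :: complex set). False"
      by eventually_elim simp
    then show False by simp
  qed
  moreover have "\<forall>i\<ge>length (a # cs). poly.coeff P' i = 0"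
    using P by (simp add: P'_def)
  ultimately show ?case
    using q q' by (intro exI[of _ P'] exI[of _ "q' * q"]) auto
qed

text \<open>A list polynomial of degree d has length d + 1, so the bound on \<open>degree P\<close>
  says that clearing denominators does not raise the degree.\<close>

lemma algebraic_relation:
  assumes f: "f \<in> carrier mero_field"
    and p: "p \<in> carrier (univ_poly mero_field (adjoin_C {exp}))" "p \<noteq> []"
      "ring.eval mero_field p f = \<zero>\<^bsub>mero_field\<^esub>"
  obtains P where "P \<noteq> 0" "\<forall>\<^sub>\<approx>z\<in>UNIV. poly (poly P [:f z:]) (exp z) = 0" "degree P < length p"
proof -
  have p': "set p \<subseteq> adjoin_C {exp}" "hd p \<noteq> \<zero>\<^bsub>mero_field\<^esub>"
    using p by (auto simp: univ_poly_def polynomial_def)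
  obtain P q where P: "P \<noteq> 0" "\<forall>i\<ge>length p. coeff P i = 0"
    "\<forall>\<^sub>\<approx>z\<in>UNIV. poly q (exp z) * ring.eval mero_field p f z = poly (poly P [:f z:]) (exp z)"
    using eval_clear_denominators[OF f p'(1)] p'(2) p(2) by auto
  have "degree P < length p"
    using P(1,2) by (meson leading_coeff_0_iff not_le)
  with P p(3) show ?thesis by (intro that[of P]) (auto simp: mero_zero)
qed

lemma poly_exp_in_adjoin_C: "(\<lambda>z. poly p (exp (z / c))) \<in> adjoin_C {\<lambda>z. exp (z / c)}"
proof (induction p)
  case 0
  show ?case using adjoin_C_const by simp
next
  case (pCons a p)
  let ?u = "\<lambda>z. exp (z / c)" and ?R = mero_field
  let ?p = "\<lambda>z. poly p (?u z)"
  have K: "subfield (adjoin_C {?u}) mero_field"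
    by (rule adjoin_C_subfield) (simp add: exp_in_mero_field)
  interpret field mero_field by (rule field_mero_field)
  have u: "?u \<in> adjoin_C {?u}" using adjoin_C_incl[of "{?u}"] by simp
  have c: "(\<lambda>_. a) \<in> carrier ?R" "?u \<in> carrier ?R" "?p \<in> carrier ?R"
    using adjoin_C_const u pCons.IH subfieldE(3)[OF K] by blast+
  have "(\<lambda>_. a) \<oplus>\<^bsub>?R\<^esub> (?u \<otimes>\<^bsub>?R\<^esub> ?p) \<in> adjoin_C {?u}"
    using adjoin_C_const u pCons.IH by (intro subringE(6,7)[OF subfieldE(1)[OF K]])
  moreover have "(\<lambda>_. a) \<oplus>\<^bsub>?R\<^esub> (?u \<otimes>\<^bsub>?R\<^esub> ?p) = (\<lambda>z. poly (pCons a p) (?u z))"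
  proof (rule mero_eqI)
    show "\<forall>\<^sub>\<approx>z\<in>UNIV. ((\<lambda>_. a) \<oplus>\<^bsub>?R\<^esub> (?u \<otimes>\<^bsub>?R\<^esub> ?p)) z = poly (pCons a p) (?u z)"
      using mero_add[OF c(1) m_closed[OF c(2,3)]] mero_mult[OF c(2,3)]
      by eventually_elim simp
    show "(\<lambda>z. poly (pCons a p) (?u z)) \<in> carrier ?R"
      by (rule holomorphic_in_mero_field[OF holomorphic_poly_exp])
  qed (use c in auto)
  ultimately show ?case by simp
qed

lemma rational_exp_in_adjoin_C:
  assumes "q \<noteq> 0" "c \<noteq> 0"
  shows "remove_sings (\<lambda>z. poly p (exp (z / c)) / poly q (exp (z / c))) \<in> adjoin_C {\<lambda>z. exp (z / c)}"
proof -
  let ?u = "\<lambda>z. exp (z / c)"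
  let ?K = "adjoin_C {?u}" and ?p = "\<lambda>z. poly p (?u z)" and ?q = "\<lambda>z. poly q (?u z)"
  interpret field mero_field by (rule field_mero_field)
  have K: "subfield ?K mero_field"
    by (rule adjoin_C_subfield) (simp add: exp_in_mero_field)
  have car: "?q \<in> carrier mero_field"
    using poly_exp_in_adjoin_C subfieldE(3)[OF K] by blast
  have nz: "?q \<noteq> \<zero>\<^bsub>mero_field\<^esub>"
  proof
    assume "?q = \<zero>\<^bsub>mero_field\<^esub>"
    with poly_exp_nonzero_cosparse[OF assms] show False
      by (simp add: mero_zero fun_eq_iff)
  qed
  have "?p \<otimes>\<^bsub>mero_field\<^esub> inv\<^bsub>mero_field\<^esub> ?q \<in> ?K"
    using poly_exp_in_adjoin_C[of p c] poly_exp_in_adjoin_C[of q c] nz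
      subfield_m_inv(1)[OF K, of ?q] subringE(6)[OF subfieldE(1)[OF K]] by simp
  also have "?p \<otimes>\<^bsub>mero_field\<^esub> inv\<^bsub>mero_field\<^esub> ?q = remove_sings (\<lambda>z. ?p z / ?q z)"
    unfolding mero_inv[OF car nz] by (simp add: mero_field_def divide_inverse)
  finally show ?thesis .
qed

text \<open>The function \<open>u\<close> is a root of X^k - e^z. Only an upper bound for its degree
  is proved here; equality is settled in the theorem by comparison with \<open>f\<close>.\<close>

lemma exp_root_algebraic:
  assumes k: "k > (0 :: nat)"
  defines "u \<equiv> \<lambda>z. exp (z / of_nat k :: complex)"
  shows "(ring.algebraic mero_field over adjoin_C {exp}) u"
    and "Polynomials.degree (ring.Irr mero_field (adjoin_C {exp}) u) \<le> k"
proof -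
  interpret field mero_field by (rule field_mero_field)
  let ?R = mero_field
  let ?K = "adjoin_C {exp}"
  have e: "exp \<in> carrier ?R" and u: "u \<in> carrier ?R"
    using exp_in_mero_field[of 1] exp_in_mero_field[of "of_nat k"] by (simp_all add: u_def)
  have K: "subfield ?K ?R"
    by (rule adjoin_C_subfield) (simp add: e)
  have eK: "exp \<in> ?K" using adjoin_C_incl[of "{exp}"] by simp
  have pow: "u [^]\<^bsub>?R\<^esub> k = exp"
  proof (rule mero_eqI)
    show "\<forall>\<^sub>\<approx>z\<in>UNIV. (u [^]\<^bsub>?R\<^esub> k) z = exp z"
      using mero_pow[OF u, of k] by eventually_elim (simp add: u_def k exp_divide_power_eq)
  qed (use e u in auto)
  \<comment> \<open>The list of X^k - e^z: leading 1, then \<open>k - 1\<close> zeros, then the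
    constant term.\<close>
  define pol where "pol = (\<one>\<^bsub>?R\<^esub> # replicate (k - 1) \<zero>\<^bsub>?R\<^esub>) @ [\<ominus>\<^bsub>?R\<^esub> exp]"
  have "set pol \<subseteq> ?K"
    using subringE(2,3)[OF subfieldE(1)[OF K]] subringE(5)[OF subfieldE(1)[OF K] eK]
    by (simp add: pol_def set_replicate_conv_if)
  moreover have "hd pol \<noteq> \<zero>\<^bsub>?R\<^esub>"
    by (simp add: pol_def)
  ultimately have pol: "pol \<in> carrier (univ_poly ?R ?K)" "pol \<noteq> []" "length pol = Suc k"
    using k by (simp_all add: pol_def univ_poly_def polynomial_def)
  have "eval pol u = (\<one>\<^bsub>?R\<^esub> \<otimes>\<^bsub>?R\<^esub> u [^]\<^bsub>?R\<^esub> (k - 1)) \<otimes>\<^bsub>?R\<^esub> u \<oplus>\<^bsub>?R\<^esub> \<ominus>\<^bsub>?R\<^esub> exp"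
    unfolding pol_def using e u eval_monom[OF one_closed u, of "k - 1"]
    by (subst eval_append_aux) (auto simp: monom_def)
  also have "\<dots> = u [^]\<^bsub>?R\<^esub> k \<oplus>\<^bsub>?R\<^esub> \<ominus>\<^bsub>?R\<^esub> exp"
    using u k nat_pow_Suc[of u "k - 1"] by simp
  also have "\<dots> = \<zero>\<^bsub>?R\<^esub>"
    unfolding pow using r_neg[OF e] by simp
  finally have root: "eval pol u = \<zero>\<^bsub>?R\<^esub>" .
  show alg: "(algebraic over ?K) u"
    using algebraicI[OF pol(1,2) root] .
  show "Polynomials.degree (Irr ?K u) \<le> k"
    using pdivides_imp_degree_le[OF subfieldE(1)[OF K] IrrE(1)[OF K u alg] pol(1,2)
        Irr_minimal[OF K u alg pol(1) root]] pol(3) by simp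
qed

text \<open>The powers of \<open>x\<close> below its degree are linearly independent inside the
  extension by \<open>y\<close>, so the degree of \<open>x\<close> is at most that of
  \<open>y\<close>; with the reverse inequality they form a basis there.\<close>

lemma (in domain) simple_extension_eqI:
  assumes K: "subfield K R" and x: "x \<in> carrier R" "(algebraic over K) x"
    and y: "y \<in> carrier R" "(algebraic over K) y"
    and sub: "simple_extension K x \<subseteq> simple_extension K y"
    and le: "Polynomials.degree (Irr K y) \<le> Polynomials.degree (Irr K x)"
  shows "simple_extension K x = simple_extension K y"
    and "Polynomials.degree (Irr K x) = Polynomials.degree (Irr K y)"
proof -
  let ?n = "Polynomials.degree (Irr K x)"
  have ind: "independent K (exp_base x ?n)" and span: "Span K (exp_base x ?n) = simple_extension K x"
    using exp_base_independent[OF K x] Span_exp_base[OF K x] by auto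
  have base: "set (exp_base x ?n) \<subseteq> simple_extension K y"
    using Span_base_incl[OF K exp_base_closed[OF x(1), of ?n]] span sub by simp
  note dim = dimension_simple_extension[OF K y]
  have "length (exp_base x ?n) \<le> Polynomials.degree (Irr K y)"
    by (rule independent_length_le_dimension[OF K dim ind base])
  with le show eq: "?n = Polynomials.degree (Irr K y)"
    by (simp add: exp_base_def)
  show "simple_extension K x = simple_extension K y"
    using independent_length_eq_dimension[OF K dim ind base] eq span
    by (simp add: exp_base_def)
qed

section \<open>Least period and degree of the extension\<close>

theorem theorem1p2:
  fixes f :: "complex \<Rightarrow> complex" and m :: nat
  assumes "f \<in> carrier mero_field"
    and "(ring.algebraic mero_field over adjoin_C {exp}) f"
    and "m = (ring.dim mero_field over adjoin_C {exp}) (adjoin_C {exp, f})"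
  shows "(0 < m \<and> (\<forall>z. f (z + 2 * of_real pi * \<i> * of_nat m) = f z)
      \<and> (\<forall>k. 0 < k \<and> (\<forall>z. f (z + 2 * of_real pi * \<i> * of_nat k) = f z) \<longrightarrow> m \<le> k))
    \<and> adjoin_C {exp, f} = adjoin_C {\<lambda>z. exp (z / of_nat m)}
    \<and> (\<exists>p q :: complex poly. q \<noteq> 0 \<and>
      f = remove_sings (\<lambda>z. poly p (exp (z / of_nat m)) / poly q (exp (z / of_nat m))))"
proof -
  interpret field mero_field by (rule field_mero_field)
  let ?K = "adjoin_C {exp}"
  let ?per = "\<lambda>k. 0 < k \<and> (\<forall>z. f (z + 2 * of_real pi * \<i> * of_nat k) = f z)"
  note f = assms(1) and alg = assms(2)
  have e: "exp \<in> carrier mero_field" using exp_in_mero_field[of 1] by simp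
  have K: "subfield ?K mero_field"
    by (rule adjoin_C_subfield) (simp add: e)
  have Irr: "Irr ?K f \<in> carrier (univ_poly mero_field ?K)" "Irr ?K f \<noteq> []" "eval (Irr ?K f) f = \<zero>\<^bsub>mero_field\<^esub>"
    using IrrE[OF K f alg] by (auto simp: ring_irreducible_def univ_poly_zero)
  obtain P where P: "P \<noteq> 0" and root: "\<forall>\<^sub>\<approx>z\<in>UNIV. poly (poly P [:f z:]) (exp z) = 0"
    and deg: "Polynomial.degree P < length (Irr ?K f)"
    using algebraic_relation[OF f Irr] .

  \<comment> \<open>Equality of two translates gives a period, after shifting \<open>z\<close> back
    by the smaller translation.\<close>
  have diff: "?per (j - i)"
    if ij: "i < j" and "\<And>z. f (z + 2 * of_real pi * \<i> * of_nat i) = f (z + 2 * of_real pi * \<i> * of_nat j)"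
    for i j
  proof (intro conjI allI)
    fix z
    show "f (z + 2 * of_real pi * \<i> * of_nat (j - i)) = f z"
      using that(2)[of "z - 2 * of_real pi * \<i> * of_nat i"] ij by (simp add: of_nat_diff algebra_simps)
  qed (use ij in simp)
  \<comment> \<open>More translates than the degree cannot be pairwise distinct, so two coincide and
    yield a period.\<close>
  have "\<not> Suc (Polynomial.degree P) \<le> Polynomial.degree P" by simp
  then have ex: "\<exists>k. ?per k"
    using conjugates_le_degree[OF f P root, of "Suc (Polynomial.degree P)"] diff by metis
  define k where "k = (LEAST k. ?per k)"
  have k: "?per k" and min: "\<And>j. ?per j \<Longrightarrow> k \<le> j"
    unfolding k_def using LeastI_ex[OF ex] Least_le[of ?per] by blast+
  \<comment> \<open>The first \<open>k\<close> translates are pairwise distinct, since a coincidence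
    would give a smaller period.\<close>
  have "k \<le> Polynomial.degree P"
  proof (rule conjugates_le_degree[OF f P root])
    fix i j assume ij: "i < j" "j < k"
    show "\<exists>z. f (z + 2 * of_real pi * \<i> * of_nat i) \<noteq> f (z + 2 * of_real pi * \<i> * of_nat j)"
      using min[OF diff[OF ij(1)]] ij by fastforce
  qed
  with deg have k_le: "k \<le> Polynomials.degree (Irr ?K f)" by simp

  let ?u = "\<lambda>z :: complex. exp (z / of_nat k)"
  obtain p q where pq: "q \<noteq> 0" "f = remove_sings (\<lambda>z. poly p (?u z) / poly q (?u z))"
    using periodic_algebraic_imp_rational[OF f P root] k by blast
  have u: "?u \<in> carrier mero_field" by (rule exp_in_mero_field)
  have fu: "f \<in> adjoin_C {?u}"
    using rational_exp_in_adjoin_C[OF pq(1), of "of_nat k" p] pq(2) k by simp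
  have "(\<lambda>z. poly (Polynomial.monom 1 k) (?u z)) = exp"
    using k by (simp add: poly_monom exp_divide_power_eq fun_eq_iff)
  then have eu: "exp \<in> adjoin_C {?u}"
    using poly_exp_in_adjoin_C[of "Polynomial.monom 1 k" "of_nat k"] by simp
  note u_alg = exp_root_algebraic[of k]
  have Kf: "adjoin_C {exp, f} = simple_extension ?K f"
    using adjoin_C_insert[OF _ f alg] e by (simp add: insert_commute)
  have Ku: "adjoin_C {?u, exp} = simple_extension ?K ?u"
    using adjoin_C_insert[OF _ u] u_alg e k by simp
  \<comment> \<open>As e^z is the \<open>k\<close>-th power of \<open>?u\<close>, adjoining
    \<open>exp\<close> adds nothing.\<close>
  have u_eq: "adjoin_C {?u, exp} = adjoin_C {?u}"
    using u e eu adjoin_C_incl[of "{?u}"] adjoin_C_incl[of "{?u, exp}"]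
    by (intro antisym adjoin_C_subsetI) auto
  have "simple_extension ?K f \<subseteq> simple_extension ?K ?u"
    unfolding Kf[symmetric] Ku[symmetric] u_eq using u eu fu by (intro adjoin_C_subsetI) auto
  note ext = simple_extension_eqI[OF K f alg u _ this]
  have le: "Polynomials.degree (Irr ?K ?u) \<le> Polynomials.degree (Irr ?K f)"
    using u_alg(2) k k_le by linarith
  \<comment> \<open>The degree of \<open>?u\<close> is at most \<open>k\<close> and that of
    \<open>f\<close> at least \<open>k\<close>; the inclusion of the extensions forces both to equal
    \<open>k\<close>.\<close>
  have "m = k"
    using ext(2)[OF _ le] u_alg k k_le simple_extension_dim[OF K f alg] assms(3) Kf by simp
  moreover have "adjoin_C {exp, f} = adjoin_C {?u}"
    using ext(1)[OF _ le] u_alg(1) k Kf Ku u_eq by simp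
  ultimately show ?thesis
    using k min pq by blast
qed

end
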